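(* Let $\mathbb{G}=(\mathbb{V},\mathbb{E})$ be a connected, locally finite, vertex-transitive and countably infinite graph. Let $p\in(0,1)$ and $h\in(0,+\infty)$, and let $q=p(1-m_h(p))$. Then, \[ \forall n \ge 0, \quad \psi_n(q) \le \frac{1}{1-m_h(p)}\, \psi_n(p)\, e^{-hn}. \]
   Context: Locally finite means that every vertex has finite degree; vertex-transitive means that for all vertices $v,w$ there is an automorphism of $\mathbb{G}$ mapping $v$ to $w$. Bernoulli bond percolation of parameter $p\in[0,1]$: each edge is open (value $1$) with probability $p$ and closed (value $0$) otherwise, independently of the other edges; $\mathbb{P}_p$ is the corresponding product probability measure on $\{0,1\}^{\mathbb{E}}$. A vertex $o\in\mathbb{V}$ is fixed once and for all. $\mathcal{C}_o$ is the cluster of $o$, i.e. the set of all vertices connected to $o$ by a path of open edges (including $o$ itself), and $|\mathcal{C}_o|$ is its cardinality. For every integer $n\ge 0$, $\psi_n(p)=\mathbb{P}_p[|\mathcal{C}_o|\ge n]$. Ghost field: given $h\in(0,+\infty)$, every vertex is in addition colored green (value $1$) with probability $1-e^{-h}$, independently of the other vertices and of the bond configuration. The joint law is the product probability measure on $\{0,1\}^{\mathbb{E}}\times\{0,1\}^{\mathbb{V}}$ \[ \mathbb{P}_{p,h} = \big(p\delta_1+(1-p)\delta_0\big)^{\otimes \mathbb{E}}\otimes\big((1-e^{-h})\delta_1+e^{-h}\delta_0\big)^{\otimes\mathbb{V}}. \] $\mathcal{G}$ denotes the (random) set of green vertices, and the magnetization is $m_h(p)=\mathbb{P}_{p,h}[\mathcal{C}_o\cap\mathcal{G}\neq\emptyset]$.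 *)

theory Defs
  imports "HOL-Probability.Probability" "HOL-Library.Extended_Nat"
begin

text \<open>
  A simple undirected graph is given by its vertex set \<open>V\<close> and its edge set \<open>E\<close>; an edge is an
  unordered pair \<open>{u, v}\<close> of distinct vertices.
\<close>

definition simple_graph :: "'v set \<Rightarrow> 'v set set \<Rightarrow> bool" where
  "simple_graph V E \<longleftrightarrow> (\<forall>e\<in>E. \<exists>u\<in>V. \<exists>v\<in>V. u \<noteq> v \<and> e = {u, v})"

definition adj_rel :: "'v set set \<Rightarrow> 'v rel" where
  "adj_rel E = {(u, v). {u, v} \<in> E}"

definition connected_graph :: "'v set \<Rightarrow> 'v set set \<Rightarrow> bool" where
  "connected_graph V E \<longleftrightarrow> (\<forall>u\<in>V. \<forall>v\<in>V. (u, v) \<in> (adj_rel E)\<^sup>*)"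

definition locally_finite_graph :: "'v set \<Rightarrow> 'v set set \<Rightarrow> bool" where
  "locally_finite_graph V E \<longleftrightarrow> (\<forall>v\<in>V. finite {e\<in>E. v \<in> e})"

definition graph_automorphism :: "'v set \<Rightarrow> 'v set set \<Rightarrow> ('v \<Rightarrow> 'v) \<Rightarrow> bool" where
  "graph_automorphism V E \<phi> \<longleftrightarrow>
     bij_betw \<phi> V V \<and> (\<forall>u\<in>V. \<forall>v\<in>V. {u, v} \<in> E \<longleftrightarrow> {\<phi> u, \<phi> v} \<in> E)"

definition vertex_transitive :: "'v set \<Rightarrow> 'v set set \<Rightarrow> bool" where
  "vertex_transitive V E \<longleftrightarrow> (\<forall>v\<in>V. \<forall>w\<in>V. \<exists>\<phi>. graph_automorphism V E \<phi> \<and> \<phi> v = w)"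

text \<open>A bond configuration is a function \<open>\<omega>\<close> on \<open>E\<close>, with value \<^const>\<open>True\<close> on the open edges.\<close>

definition bond_percolation :: "'v set set \<Rightarrow> real \<Rightarrow> ('v set \<Rightarrow> bool) measure" where
  "bond_percolation E p = Pi\<^sub>M E (\<lambda>_. measure_pmf (bernoulli_pmf p))"

definition cluster :: "'v set set \<Rightarrow> ('v set \<Rightarrow> bool) \<Rightarrow> 'v \<Rightarrow> 'v set" where
  "cluster E \<omega> v = {w. (v, w) \<in> (adj_rel {e\<in>E. \<omega> e})\<^sup>*}"

text \<open>
  Clusters may be infinite, so that their cardinality is taken in \<^typ>\<open>enat\<close>
  (\<^const>\<open>card\<close> would be \<open>0\<close> on an infinite set).
\<close>

definition ecard :: "'a set \<Rightarrow> enat" where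
  "ecard A = (if finite A then enat (card A) else \<infinity>)"

definition \<psi> :: "'v set set \<Rightarrow> 'v \<Rightarrow> nat \<Rightarrow> real \<Rightarrow> real" where
  "\<psi> E v n p = measure (bond_percolation E p)
     {\<omega> \<in> space (bond_percolation E p). ecard (cluster E \<omega> v) \<ge> enat n}"

definition ghost_field :: "'v set \<Rightarrow> real \<Rightarrow> ('v \<Rightarrow> bool) measure" where
  "ghost_field V h = Pi\<^sub>M V (\<lambda>_. measure_pmf (bernoulli_pmf (1 - exp (- h))))"

definition ghost_percolation ::
    "'v set \<Rightarrow> 'v set set \<Rightarrow> real \<Rightarrow> real \<Rightarrow> (('v set \<Rightarrow> bool) \<times> ('v \<Rightarrow> bool)) measure" where
  "ghost_percolation V E p h = bond_percolation E p \<Otimes>\<^sub>M ghost_field V h"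

definition green :: "'v set \<Rightarrow> ('v \<Rightarrow> bool) \<Rightarrow> 'v set" where
  "green V \<eta> = {v\<in>V. \<eta> v}"

definition magnetization :: "'v set \<Rightarrow> 'v set set \<Rightarrow> 'v \<Rightarrow> real \<Rightarrow> real \<Rightarrow> real" where
  "magnetization V E v h p = measure (ghost_percolation V E p h)
     {(\<omega>, \<eta>) \<in> space (ghost_percolation V E p h). cluster E \<omega> v \<inter> green V \<eta> \<noteq> {}}"

end

theory Submission
  imports Defs
begin

text \<open>
  Condition on the event that the cluster of the origin contains no green vertex, and explore this
  cluster edge by edge. When the edge \<open>{x, y}\<close> is explored from \<open>x\<close>, opening it adds to the cluster
  whatever \<open>y\<close> can reach through the unexplored edges, so the price to pay is that this extra set has
  to avoid the green vertices as well. By positive correlation this costs at most a factor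
  \<open>1 - m\<close>, where \<open>m\<close> is the magnetization at \<open>y\<close>, which by transitivity is the magnetization at the
  origin. So, conditionally on the past, each explored edge is open with probability at least
  \<open>q = p (1 - m)\<close>, and the cluster under the conditioned law dominates the cluster at parameter
  \<open>q\<close>. A cluster \<open>C\<close> avoids the green vertices with conditional probability \<open>exp (- h |C|)\<close>, hence
  \<open>\<psi> n q \<le> E (1 {|C| \<ge> n} exp (- h |C|)) / (1 - m) \<le> \<psi> n p exp (- h n) / (1 - m).\<close>

  The exploration is carried out on a finite set \<open>F\<close> of edges, where expectations are finite sums.
  Integrating out the green vertices beforehand turns the conditioned law into the percolation law
  weighted by \<open>w C = exp (- h |C|)\<close>. The domination, \<open>tilted_cluster_domination\<close>, is then an
  induction on \<open>F\<close> in which one edge at the boundary of the explored set is revealed in each step,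
  and the positive correlation is \<open>harris_inequality\<close>.

  To return to the infinite graph, two facts are needed. Clusters inside \<open>F\<close> are contained in
  clusters of the whole graph, so the \<open>F\<close>-local expectation of \<open>w\<close> is at least \<open>1 - m\<close>, uniformly in
  the starting vertex (\<open>one_minus_magnetization_le_local_any_vertex\<close>); this is where transitivity
  enters, and only finite sums have to be transported by the automorphism. And the local versions of
  \<open>\<psi>\<close> increase to \<open>\<psi>\<close> along an exhaustion of the edges by finite sets
  (\<open>exhaustion_tendsto_\<psi>\<close>, \<open>local_le_\<psi>\<close>). Finally \<open>m < 1\<close>, because with
  positive probability the origin is isolated and not green.
\<close>

section \<open>Vertices reachable through a set of edges\<close>

text \<open>
  Clusters are written as a function of the set of open edges, and started from a set \<open>A\<close> of vertices:
  in the exploration, \<open>A\<close> is the part of the cluster that has been discovered so far.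
\<close>

definition reach :: "'v set set \<Rightarrow> 'v set \<Rightarrow> 'v set" where
  "reach S A = (adj_rel S)\<^sup>* `` A"

lemma cluster_eq_reach: "cluster F \<omega> v = reach {e\<in>F. \<omega> e} {v}"
  by (auto simp: cluster_def reach_def)

lemma reach_mono:
  assumes "S \<subseteq> T" "A \<subseteq> B"
  shows "reach S A \<subseteq> reach T B"
proof -
  have "(adj_rel S)\<^sup>* \<subseteq> (adj_rel T)\<^sup>*"
    using assms(1) by (intro rtrancl_mono) (auto simp: adj_rel_def)
  with assms(2) show ?thesis
    unfolding reach_def by blast
qed

lemma reach_Un: "reach S (A \<union> B) = reach S A \<union> reach S B"
  unfolding reach_def by (rule Image_Un)

lemma subset_reach: "A \<subseteq> reach S A"
  unfolding reach_def by blast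

lemma reach_step: "u \<in> reach S A \<Longrightarrow> {u, w} \<in> S \<Longrightarrow> w \<in> reach S A"
  unfolding reach_def adj_rel_def by (auto intro: rtrancl_into_rtrancl)

lemma reach_least:
  assumes "A \<subseteq> B" and "\<And>u w. u \<in> B \<Longrightarrow> {u, w} \<in> S \<Longrightarrow> w \<in> B"
  shows "reach S A \<subseteq> B"
proof
  fix w assume "w \<in> reach S A"
  then obtain v where "v \<in> A" "(v, w) \<in> (adj_rel S)\<^sup>*"
    by (auto simp: reach_def)
  from this(2) show "w \<in> B"
    by (induction rule: rtrancl_induct) (use assms \<open>v \<in> A\<close> in \<open>auto simp: adj_rel_def\<close>)
qed

lemma reach_subset_Union: "reach S A \<subseteq> A \<union> \<Union>S"
  by (rule reach_least) auto

lemma finite_reach: "finite S \<Longrightarrow> (\<And>e. e \<in> S \<Longrightarrow> finite e) \<Longrightarrow> finite A \<Longrightarrow> finite (reach S A)"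
  by (rule finite_subset[OF reach_subset_Union]) auto

text \<open>
  The exploration step: opening an edge at an explored vertex amounts to declaring its other endpoint
  explored, and afterwards the edge can be forgotten.
\<close>

lemma reach_insert_edge:
  assumes "x \<in> A"
  shows "reach (insert {x, y} S) A = reach S (insert y A)"
proof
  show "reach (insert {x, y} S) A \<subseteq> reach S (insert y A)"
  proof (rule reach_least)
    fix u w assume u: "u \<in> reach S (insert y A)" "{u, w} \<in> insert {x, y} S"
    show "w \<in> reach S (insert y A)"
    proof (cases "{u, w} \<in> S")
      case False
      with u have "w \<in> {x, y}" by auto
      with assms subset_reach[of "insert y A" S] show ?thesis by auto
    qed (use u in \<open>auto intro: reach_step\<close>)
  qed (use subset_reach[of "insert y A" S] in auto)
  have "x \<in> reach (insert {x, y} S) A"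
    using subset_reach[of A] assms by blast
  then have "y \<in> reach (insert {x, y} S) A"
    by (rule reach_step) simp
  then show "reach S (insert y A) \<subseteq> reach (insert {x, y} S) A"
    using subset_reach[of A "insert {x, y} S"]
    by (intro reach_least) (auto intro: reach_step)
qed

lemma reach_without_edges:
  assumes "\<And>e. e \<in> S \<Longrightarrow> e \<inter> A = {}"
  shows "reach S A = A"
proof (rule subset_antisym)
  show "reach S A \<subseteq> A"
    by (rule reach_least) (use assms in blast)+
qed (rule subset_reach)

lemma edge_subset_vertices: "simple_graph V E \<Longrightarrow> e \<in> E \<Longrightarrow> e \<subseteq> V"
  unfolding simple_graph_def by fastforce

lemma finite_edge: "simple_graph V E \<Longrightarrow> e \<in> E \<Longrightarrow> finite e"
  unfolding simple_graph_def by fastforce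

lemma countable_edges:
  assumes "simple_graph V E" "countable V"
  shows "countable E"
proof (rule countable_subset)
  show "E \<subseteq> (\<lambda>(u, v). {u, v}) ` (V \<times> V)"
    using assms(1) unfolding simple_graph_def by fastforce
qed (use assms(2) in simp)

section \<open>Expectations over finitely many independent edges\<close>

definition bernoulli_weight :: "real \<Rightarrow> 'a set \<Rightarrow> 'a set \<Rightarrow> real" where
  "bernoulli_weight p F S = (\<Prod>e\<in>F. if e \<in> S then p else 1 - p)"

definition bernoulli_expectation :: "real \<Rightarrow> 'a set \<Rightarrow> ('a set \<Rightarrow> real) \<Rightarrow> real" where
  "bernoulli_expectation p F f = (\<Sum>S\<in>Pow F. bernoulli_weight p F S * f S)"

lemma bernoulli_weight_nonneg: "0 \<le> p \<Longrightarrow> p \<le> 1 \<Longrightarrow> 0 \<le> bernoulli_weight p F S"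
  unfolding bernoulli_weight_def by (intro prod_nonneg) auto

lemma bernoulli_expectation_empty: "bernoulli_expectation p {} f = f {}"
  by (simp add: bernoulli_expectation_def bernoulli_weight_def)

lemma bernoulli_expectation_mult_left:
  "bernoulli_expectation p F (\<lambda>S. c * f S) = c * bernoulli_expectation p F f"
  by (simp add: bernoulli_expectation_def sum_distrib_left mult_ac)

lemma bernoulli_expectation_mono:
  assumes "0 \<le> p" "p \<le> 1" "\<And>S. S \<subseteq> F \<Longrightarrow> f S \<le> g S"
  shows "bernoulli_expectation p F f \<le> bernoulli_expectation p F g"
  unfolding bernoulli_expectation_def
  by (intro sum_mono mult_left_mono bernoulli_weight_nonneg) (use assms in auto)

lemma bernoulli_expectation_cong:
  "(\<And>S. S \<subseteq> F \<Longrightarrow> f S = g S) \<Longrightarrow> bernoulli_expectation p F f = bernoulli_expectation p F g"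
  unfolding bernoulli_expectation_def by (intro sum.cong) auto

text \<open>
  Conditioning on the state of one edge. The inductions over the edge set rest on this recursion.
\<close>

lemma bernoulli_expectation_insert:
  assumes "finite F" "e \<notin> F"
  shows "bernoulli_expectation p (insert e F) f =
    p * bernoulli_expectation p F (\<lambda>S. f (insert e S)) + (1 - p) * bernoulli_expectation p F f"
proof -
  have w1: "bernoulli_weight p (insert e F) (insert e S) = p * bernoulli_weight p F S" if "S \<subseteq> F" for S
  proof -
    have "(\<Prod>x\<in>F. if x \<in> insert e S then p else 1 - p) = (\<Prod>x\<in>F. if x \<in> S then p else 1 - p)"
      by (rule prod.cong) (use assms in auto)
    then show ?thesis using assms by (simp add: bernoulli_weight_def)
  qed
  have w0: "bernoulli_weight p (insert e F) S = (1 - p) * bernoulli_weight p F S" if "S \<subseteq> F" for S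
    using assms that by (auto simp: bernoulli_weight_def)
  have inj: "inj_on (insert e) (Pow F)"
  proof (rule inj_onI)
    fix S T assume "S \<in> Pow F" "T \<in> Pow F" "insert e S = insert e T"
    moreover from this assms(2) have "e \<notin> S" "e \<notin> T" by auto
    ultimately show "S = T" by (simp add: insert_ident)
  qed
  have "bernoulli_expectation p (insert e F) f =
      (\<Sum>S\<in>Pow F. bernoulli_weight p (insert e F) S * f S) +
      (\<Sum>S\<in>insert e ` Pow F. bernoulli_weight p (insert e F) S * f S)"
    unfolding bernoulli_expectation_def Pow_insert
    by (rule sum.union_disjoint) (use assms in auto)
  also have "(\<Sum>S\<in>insert e ` Pow F. bernoulli_weight p (insert e F) S * f S) =
      p * bernoulli_expectation p F (\<lambda>S. f (insert e S))"
    unfolding bernoulli_expectation_def sum_distrib_left sum.reindex[OF inj]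
    by (rule sum.cong) (auto simp: w1)
  also have "(\<Sum>S\<in>Pow F. bernoulli_weight p (insert e F) S * f S) = (1 - p) * bernoulli_expectation p F f"
    unfolding bernoulli_expectation_def sum_distrib_left
    by (rule sum.cong) (auto simp: w0)
  finally show ?thesis by simp
qed

lemma bernoulli_expectation_const:
  "finite F \<Longrightarrow> bernoulli_expectation p F (\<lambda>_. c) = c"
  by (induction F rule: finite_induct)
    (simp_all add: bernoulli_expectation_empty bernoulli_expectation_insert algebra_simps)

text \<open>
  Given the state of one edge, the induction hypothesis bounds both conditional expectations; what
  remains is positive correlation for a single Bernoulli variable, that is, the nonnegativity of
  \<open>p (1 - p) (f\<^sub>0 - f\<^sub>1) (g\<^sub>0 - g\<^sub>1)\<close>.
\<close>

lemma harris_inequality: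
  assumes "finite F" "0 \<le> p" "p \<le> 1"
    and "\<And>S T. S \<subseteq> T \<Longrightarrow> T \<subseteq> F \<Longrightarrow> f T \<le> f S"
    and "\<And>S T. S \<subseteq> T \<Longrightarrow> T \<subseteq> F \<Longrightarrow> g T \<le> g S"
  shows "bernoulli_expectation p F f * bernoulli_expectation p F g
    \<le> bernoulli_expectation p F (\<lambda>S. f S * g S)"
  using assms(1,4,5)
proof (induction F arbitrary: f g rule: finite_induct)
  case empty
  then show ?case by (simp add: bernoulli_expectation_empty)
next
  case (insert e F)
  let ?E = "bernoulli_expectation p F"
  let ?f1 = "?E (\<lambda>S. f (insert e S))" and ?g1 = "?E (\<lambda>S. g (insert e S))"
  have IH1: "?f1 * ?g1 \<le> ?E (\<lambda>S. f (insert e S) * g (insert e S))"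
    by (rule insert.IH) (auto intro!: insert.prems)
  have IH0: "?E f * ?E g \<le> ?E (\<lambda>S. f S * g S)"
    by (rule insert.IH) (auto intro!: insert.prems)
  have "?f1 \<le> ?E f" "?g1 \<le> ?E g"
    by (auto intro!: bernoulli_expectation_mono assms insert.prems)
  then have "0 \<le> p * (1 - p) * ((?E f - ?f1) * (?E g - ?g1))"
    using assms by simp
  also have "\<dots> = p * (?f1 * ?g1) + (1 - p) * (?E f * ?E g)
      - (p * ?f1 + (1 - p) * ?E f) * (p * ?g1 + (1 - p) * ?E g)"
    by (simp add: algebra_simps)
  also have "p * (?f1 * ?g1) + (1 - p) * (?E f * ?E g) \<le>
      p * ?E (\<lambda>S. f (insert e S) * g (insert e S)) + (1 - p) * ?E (\<lambda>S. f S * g S)"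
    using assms by (intro add_mono mult_left_mono IH1 IH0) auto
  finally show ?case
    by (simp add: bernoulli_expectation_insert[OF insert.hyps])
qed

section \<open>Domination by the weighted cluster\<close>

text \<open>
  Divided by the expectation of \<open>w\<close>, this says that the cluster under the law with density proportional
  to \<open>w\<close> dominates the cluster at parameter \<open>q\<close>. The hypothesis \<open>w A * w B \<le> w (A \<union> B)\<close> stands for
  two sets avoiding the green vertices being positively correlated, and the last hypothesis says that
  \<open>q\<close> is at most \<open>p\<close> times the chance that a newly reached vertex \<open>y\<close> brings no green vertex.

  Let \<open>a\<^sub>0\<close> and \<open>a\<^sub>1\<close> be the conditional expectations of \<open>w\<close> given that an edge at the boundary of \<open>A\<close>
  is closed or open, and \<open>g\<^sub>0 \<le> g\<^sub>1\<close> those of \<open>g\<close> at parameter \<open>q\<close>. Under the weighted law the edge is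
  open with probability \<open>p a\<^sub>1 / (p a\<^sub>1 + (1 - p) a\<^sub>0)\<close>. This is at least \<open>q\<close>, because
  \<open>a\<^sub>1 \<le> a\<^sub>0\<close> and because Harris' inequality and the hypothesis on \<open>q\<close> give
  \<open>q a\<^sub>0 \<le> p a\<^sub>1\<close>.
\<close>

lemma tilted_cluster_domination:
  fixes w g :: "'v set \<Rightarrow> real"
  assumes "finite F" and "\<And>e. e \<in> F \<Longrightarrow> \<exists>x y. e = {x, y}" and "finite A"
    and p: "0 \<le> p" "p \<le> 1" and q: "0 \<le> q" "q \<le> 1"
    and w_nonneg: "\<And>A. 0 \<le> w A"
    and w_anti: "\<And>A B. finite B \<Longrightarrow> A \<subseteq> B \<Longrightarrow> w B \<le> w A"
    and w_Un: "\<And>A B. finite A \<Longrightarrow> finite B \<Longrightarrow> w A * w B \<le> w (A \<union> B)"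
    and g_mono: "\<And>A B. finite B \<Longrightarrow> A \<subseteq> B \<Longrightarrow> g A \<le> g B"
    and q_le: "\<And>y. y \<in> \<Union>F \<Longrightarrow> q \<le> p * bernoulli_expectation p F (\<lambda>S. w (reach S {y}))"
  shows "bernoulli_expectation q F (\<lambda>S. g (reach S A)) * bernoulli_expectation p F (\<lambda>S. w (reach S A))
    \<le> bernoulli_expectation p F (\<lambda>S. g (reach S A) * w (reach S A))"
  using assms(1-3) q_le
proof (induction "card F" arbitrary: F A rule: less_induct)
  case less
  show ?case
  proof (cases "\<exists>e\<in>F. e \<inter> A \<noteq> {}")
    case False
    then have r: "reach S A = A" if "S \<subseteq> F" for S
      using that by (intro reach_without_edges) blast
    have "bernoulli_expectation c F (\<lambda>S. k (reach S A)) = k A" for c and k :: "'v set \<Rightarrow> real"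
      using bernoulli_expectation_cong[of F "\<lambda>S. k (reach S A)" "\<lambda>_. k A" c] r
        bernoulli_expectation_const[OF less.prems(1)] by simp
    note this[of _ g] this[of _ w] this[of _ "\<lambda>S. g S * w S"]
    then show ?thesis by simp
  next
    case True
    then obtain x y where xy: "{x, y} \<in> F" "x \<in> A"
      using less.prems(2) by (metis disjoint_iff doubleton_eq_iff insert_iff singletonD)
    define F' where "F' = F - {{x, y}}"
    have F: "F = insert {x, y} F'" "{x, y} \<notin> F'" and fin: "finite F'"
      using xy less.prems(1) by (auto simp: F'_def)
    have card: "card F' < card F"
      using F fin by simp
    have edges: "\<exists>x y. e = {x, y}" if "e \<in> F'" for e
      using that less.prems(2) F by blast
    have finr: "finite (reach S B)" if "S \<subseteq> F" "finite B" for S B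
    proof (rule finite_reach)
      show "finite e" if "e \<in> S" for e
        using that \<open>S \<subseteq> F\<close> less.prems(2)[of e] by auto
    qed (use that less.prems(1) finite_subset in auto)
    have finr': "finite (reach S B)" if "S \<subseteq> F'" "finite B" for S B
      using that F finr by blast
    let ?A' = "insert y A"
    let ?E = "\<lambda>c. bernoulli_expectation c F'"
    have step: "bernoulli_expectation c F (\<lambda>S. k (reach S A)) =
        c * ?E c (\<lambda>S. k (reach S ?A')) + (1 - c) * ?E c (\<lambda>S. k (reach S A))"
      for c and k :: "'v set \<Rightarrow> real"
      unfolding F(1) bernoulli_expectation_insert[OF fin F(2)] reach_insert_edge[OF xy(2)] ..
    have anti: "w (reach T B) \<le> w (reach S B')"
      if "S \<subseteq> T" "T \<subseteq> F" "B' \<subseteq> B" "finite B" for S T B B'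
      using that by (intro w_anti finr reach_mono)
    \<comment> \<open>Removing an edge makes clusters smaller, so the hypothesis on \<open>q\<close> passes to \<open>F'\<close>. It is kept for
      all endpoints of \<open>F\<close>, since \<open>y\<close> itself may not be an endpoint of an edge in \<open>F'\<close>.\<close>
    have q': "q \<le> p * ?E p (\<lambda>S. w (reach S {z}))" if "z \<in> \<Union>F" for z
    proof -
      have le: "?E p (\<lambda>S. w (reach (insert {x, y} S) {z})) \<le> ?E p (\<lambda>S. w (reach S {z}))"
        using F by (intro bernoulli_expectation_mono p anti) auto
      have "bernoulli_expectation p F (\<lambda>S. w (reach S {z})) \<le> ?E p (\<lambda>S. w (reach S {z}))"
        unfolding F(1) bernoulli_expectation_insert[OF fin F(2)]
        using mult_left_mono[OF le p(1)] by (simp add: algebra_simps)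
      then show ?thesis
        using less.prems(4)[OF that] mult_left_mono[OF _ p(1)] by (meson order_trans)
    qed
    let ?a0 = "?E p (\<lambda>S. w (reach S A))" and ?a1 = "?E p (\<lambda>S. w (reach S ?A'))"
    let ?g0 = "?E q (\<lambda>S. g (reach S A))" and ?g1 = "?E q (\<lambda>S. g (reach S ?A'))"
    let ?b0 = "?E p (\<lambda>S. g (reach S A) * w (reach S A))"
    let ?b1 = "?E p (\<lambda>S. g (reach S ?A') * w (reach S ?A'))"
    have IH0: "?g0 * ?a0 \<le> ?b0"
      using F less.prems(3) by (intro less.hyps card fin edges q') auto
    have IH1: "?g1 * ?a1 \<le> ?b1"
      using F less.prems(3) by (intro less.hyps card fin edges q') auto
    have g01: "?g0 \<le> ?g1"
      using less.prems(3) by (intro bernoulli_expectation_mono q g_mono finr' reach_mono) auto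
    have a10: "?a1 \<le> ?a0"
      using F less.prems(3) by (intro bernoulli_expectation_mono p anti) auto
    have a0: "0 \<le> ?a0"
      using bernoulli_expectation_mono[OF p, of F' "\<lambda>_. 0" "\<lambda>S. w (reach S A)"]
      by (simp add: w_nonneg bernoulli_expectation_const[OF fin])
    have "?a0 * ?E p (\<lambda>S. w (reach S {y})) \<le> ?E p (\<lambda>S. w (reach S A) * w (reach S {y}))"
      using F less.prems(3) by (intro harris_inequality fin p anti) auto
    also have "\<dots> \<le> ?a1"
    proof (rule bernoulli_expectation_mono[OF p])
      fix S assume "S \<subseteq> F'"
      then show "w (reach S A) * w (reach S {y}) \<le> w (reach S ?A')"
        using w_Un[of "reach S A" "reach S {y}"] finr' less.prems(3) reach_Un[of S A "{y}"] by simp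
    qed
    finally have harris: "?a0 * ?E p (\<lambda>S. w (reach S {y})) \<le> ?a1" .
    have "q * (p * ?a1 + (1 - p) * ?a0) \<le> q * ?a0"
      using mult_left_mono[OF a10 p(1)] by (intro mult_left_mono q) (simp add: algebra_simps)
    also have "\<dots> \<le> p * ?E p (\<lambda>S. w (reach S {y})) * ?a0"
      using xy by (intro mult_right_mono a0 q') auto
    also have "\<dots> \<le> p * ?a1"
      using mult_left_mono[OF harris p(1)] by (simp add: mult_ac)
    \<comment> \<open>The weighted probability of an open edge is at least \<open>q\<close>; multiplied by \<open>g\<^sub>1 - g\<^sub>0\<close>, this is the
      difference between the averages of \<open>g\<close> under the two laws of the edge, up to normalization.\<close>
    finally have "0 \<le> (?g1 - ?g0) * (p * ?a1 - q * (p * ?a1 + (1 - p) * ?a0))"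
      using g01 by simp
    also have "\<dots> = p * (?g1 * ?a1) + (1 - p) * (?g0 * ?a0)
        - (q * ?g1 + (1 - q) * ?g0) * (p * ?a1 + (1 - p) * ?a0)"
      by (simp add: algebra_simps)
    also have "p * (?g1 * ?a1) + (1 - p) * (?g0 * ?a0) \<le> p * ?b1 + (1 - p) * ?b0"
      using p by (intro add_mono mult_left_mono IH0 IH1) auto
    finally show ?thesis
      using step[of q g] step[of p w] step[of p "\<lambda>B. g B * w B"] by simp
  qed
qed

section \<open>Events depending on finitely many coordinates\<close>

abbreviation bernoulli_field :: "'a set \<Rightarrow> real \<Rightarrow> ('a \<Rightarrow> bool) measure" where
  "bernoulli_field I p \<equiv> Pi\<^sub>M I (\<lambda>_. measure_pmf (bernoulli_pmf p))"

lemma prob_space_bernoulli_field: "prob_space (bernoulli_field I p)"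
  by (rule prob_space_PiM) (rule prob_space_measure_pmf)

lemma
  fixes p :: real
  assumes "J \<subseteq> I" "finite J"
  shows sets_cylinder: "{x \<in> space (bernoulli_field I p). \<forall>i\<in>J. x i = b i} \<in> sets (bernoulli_field I p)"
    and measure_cylinder: "0 \<le> p \<Longrightarrow> p \<le> 1 \<Longrightarrow>
      measure (bernoulli_field I p) {x \<in> space (bernoulli_field I p). \<forall>i\<in>J. x i = b i} =
      (\<Prod>i\<in>J. if b i then p else 1 - p)"
proof -
  interpret product_prob_space "\<lambda>_. measure_pmf (bernoulli_pmf p)" I
    by (rule product_prob_spaceI) (rule prob_space_measure_pmf)
  have eq: "{x \<in> space (bernoulli_field I p). \<forall>i\<in>J. x i = b i} =
      prod_emb I (\<lambda>_. measure_pmf (bernoulli_pmf p)) J (Pi\<^sub>E J (\<lambda>i. {b i}))"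
    unfolding prod_emb_def using assms(1) by (auto simp: space_PiM Pi_iff)
  show "{x \<in> space (bernoulli_field I p). \<forall>i\<in>J. x i = b i} \<in> sets (bernoulli_field I p)"
    unfolding eq using assms by (intro sets_PiM_I) auto
  assume p: "0 \<le> p" "p \<le> 1"
  have "measure (bernoulli_field I p) {x \<in> space (bernoulli_field I p). \<forall>i\<in>J. x i = b i} =
      (\<Prod>i\<in>J. measure (measure_pmf (bernoulli_pmf p)) {b i})"
    unfolding eq using assms by (intro measure_PiM_emb) auto
  also have "\<dots> = (\<Prod>i\<in>J. if b i then p else 1 - p)"
    using p by (intro prod.cong) (auto simp: measure_pmf_single)
  finally show "measure (bernoulli_field I p) {x \<in> space (bernoulli_field I p). \<forall>i\<in>J. x i = b i} =
      (\<Prod>i\<in>J. if b i then p else 1 - p)" .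
qed

lemma
  assumes "F \<subseteq> E" "finite F" "S \<subseteq> F"
  shows sets_open_edges_eq:
      "{\<omega> \<in> space (bond_percolation E p). {e\<in>F. \<omega> e} = S} \<in> sets (bond_percolation E p)"
    and measure_open_edges_eq: "0 \<le> p \<Longrightarrow> p \<le> 1 \<Longrightarrow>
      measure (bond_percolation E p) {\<omega> \<in> space (bond_percolation E p). {e\<in>F. \<omega> e} = S} =
      bernoulli_weight p F S"
proof -
  have eq: "{\<omega> \<in> space (bond_percolation E p). {e\<in>F. \<omega> e} = S} =
      {\<omega> \<in> space (bond_percolation E p). \<forall>e\<in>F. \<omega> e = (e \<in> S)}"
    using assms(3) by auto
  show "{\<omega> \<in> space (bond_percolation E p). {e\<in>F. \<omega> e} = S} \<in> sets (bond_percolation E p)"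
    unfolding eq unfolding bond_percolation_def by (rule sets_cylinder[OF assms(1,2)])
  show "measure (bond_percolation E p) {\<omega> \<in> space (bond_percolation E p). {e\<in>F. \<omega> e} = S} =
      bernoulli_weight p F S" if "0 \<le> p" "p \<le> 1"
    unfolding eq unfolding bond_percolation_def bernoulli_weight_def
    by (rule measure_cylinder[OF assms(1,2) that])
qed

lemma
  assumes "F \<subseteq> E" "finite F"
  shows sets_local_event:
      "{\<omega> \<in> space (bond_percolation E p). P {e\<in>F. \<omega> e}} \<in> sets (bond_percolation E p)"
    and measure_local_event: "0 \<le> p \<Longrightarrow> p \<le> 1 \<Longrightarrow>
      measure (bond_percolation E p) {\<omega> \<in> space (bond_percolation E p). P {e\<in>F. \<omega> e}} =
      bernoulli_expectation p F (\<lambda>S. of_bool (P S))"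
proof -
  let ?M = "bond_percolation E p"
  let ?A = "\<lambda>S. {\<omega> \<in> space ?M. {e\<in>F. \<omega> e} = S}"
  let ?I = "{S \<in> Pow F. P S}"
  have fin: "finite ?I" using assms(2) by simp
  have eq: "{\<omega> \<in> space ?M. P {e\<in>F. \<omega> e}} = (\<Union>S\<in>?I. ?A S)"
    by auto
  show "{\<omega> \<in> space ?M. P {e\<in>F. \<omega> e}} \<in> sets ?M"
    unfolding eq using fin by (intro sets.finite_UN sets_open_edges_eq[OF assms]) auto
  assume p: "0 \<le> p" "p \<le> 1"
  interpret prob_space ?M
    unfolding bond_percolation_def by (rule prob_space_bernoulli_field)
  have "measure ?M {\<omega> \<in> space ?M. P {e\<in>F. \<omega> e}} = (\<Sum>S\<in>?I. measure ?M (?A S))"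
    unfolding eq using fin
    by (intro finite_measure_finite_Union)
      (auto simp: disjoint_family_on_def intro!: sets_open_edges_eq[OF assms])
  also have "\<dots> = (\<Sum>S\<in>?I. bernoulli_weight p F S)"
    by (intro sum.cong measure_open_edges_eq[OF assms _ p]) auto
  also have "\<dots> = bernoulli_expectation p F (\<lambda>S. of_bool (P S))"
    unfolding bernoulli_expectation_def using assms(2)
    by (intro sum.mono_neutral_cong_left) auto
  finally show "measure ?M {\<omega> \<in> space ?M. P {e\<in>F. \<omega> e}} = bernoulli_expectation p F (\<lambda>S. of_bool (P S))" .
qed

lemma prob_space_ghost_percolation: "prob_space (ghost_percolation V E p h)"
  unfolding ghost_percolation_def bond_percolation_def ghost_field_def
  by (intro prob_space_pair prob_space_bernoulli_field)

lemma
  assumes "A \<subseteq> V" "finite A"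
  shows sets_no_green: "{\<eta> \<in> space (ghost_field V h). A \<inter> green V \<eta> = {}} \<in> sets (ghost_field V h)"
    and measure_no_green: "0 < h \<Longrightarrow>
      measure (ghost_field V h) {\<eta> \<in> space (ghost_field V h). A \<inter> green V \<eta> = {}} =
      exp (- h * real (card A))"
proof -
  have eq: "{\<eta> \<in> space (ghost_field V h). A \<inter> green V \<eta> = {}} =
      {\<eta> \<in> space (ghost_field V h). \<forall>v\<in>A. \<eta> v = False}"
    using assms(1) by (auto simp: green_def)
  show "{\<eta> \<in> space (ghost_field V h). A \<inter> green V \<eta> = {}} \<in> sets (ghost_field V h)"
    unfolding eq unfolding ghost_field_def by (rule sets_cylinder[OF assms])
  assume "0 < h"
  then have "measure (ghost_field V h) {\<eta> \<in> space (ghost_field V h). A \<inter> green V \<eta> = {}} =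
      (\<Prod>v\<in>A. if False then 1 - exp (- h) else 1 - (1 - exp (- h)))"
    unfolding eq unfolding ghost_field_def by (intro measure_cylinder[OF assms]) auto
  also have "\<dots> = exp (- h * real (card A))"
    by (simp add: exp_of_nat_mult[symmetric] mult_ac)
  finally show "measure (ghost_field V h) {\<eta> \<in> space (ghost_field V h). A \<inter> green V \<eta> = {}} =
      exp (- h * real (card A))" .
qed

text \<open>
  Given the bond configuration, a finite cluster \<open>C\<close> avoids the green vertices with probability
  \<open>exp (- h |C|)\<close>; summing over the states of the edges in \<open>F\<close> integrates out the green vertices.
\<close>

lemma
  assumes "simple_graph V E" "F \<subseteq> E" "finite F" "v \<in> V"
  shows sets_local_cluster_no_green:
      "{(\<omega>, \<eta>) \<in> space (ghost_percolation V E p h). cluster F \<omega> v \<inter> green V \<eta> = {}}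
        \<in> sets (ghost_percolation V E p h)"
    and measure_local_cluster_no_green: "0 \<le> p \<Longrightarrow> p \<le> 1 \<Longrightarrow> 0 < h \<Longrightarrow>
      measure (ghost_percolation V E p h)
        {(\<omega>, \<eta>) \<in> space (ghost_percolation V E p h). cluster F \<omega> v \<inter> green V \<eta> = {}} =
      bernoulli_expectation p F (\<lambda>S. exp (- h * real (card (reach S {v}))))"
proof -
  let ?B = "bond_percolation E p" and ?G = "ghost_field V h" and ?M = "ghost_percolation V E p h"
  let ?A = "\<lambda>S. {\<omega> \<in> space ?B. {e\<in>F. \<omega> e} = S} \<times> {\<eta> \<in> space ?G. reach S {v} \<inter> green V \<eta> = {}}"
  interpret prob_space ?M by (rule prob_space_ghost_percolation)
  interpret G: prob_space ?G
    unfolding ghost_field_def by (rule prob_space_bernoulli_field)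
  have sub: "reach S {v} \<subseteq> V" and fin: "finite (reach S {v})" if "S \<subseteq> F" for S
  proof -
    have "e \<subseteq> V \<and> finite e" if "e \<in> S" for e
      using that \<open>S \<subseteq> F\<close> assms(2) edge_subset_vertices[OF assms(1)] finite_edge[OF assms(1)] by blast
    with \<open>S \<subseteq> F\<close> assms(3,4) show "reach S {v} \<subseteq> V" "finite (reach S {v})"
      using reach_subset_Union[of S "{v}"] finite_reach[of S "{v}"] finite_subset by blast+
  qed
  have sp: "space ?M = space ?B \<times> space ?G" and sM: "sets ?M = sets (?B \<Otimes>\<^sub>M ?G)"
    by (simp_all add: ghost_percolation_def space_pair_measure)
  have eq: "{(\<omega>, \<eta>) \<in> space ?M. cluster F \<omega> v \<inter> green V \<eta> = {}} = (\<Union>S\<in>Pow F. ?A S)"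
    by (auto simp: sp cluster_eq_reach)
  have A: "?A S \<in> sets ?M" if "S \<subseteq> F" for S
    unfolding sM using that assms
    by (intro pair_measureI sets_open_edges_eq sets_no_green sub fin) auto
  show "{(\<omega>, \<eta>) \<in> space ?M. cluster F \<omega> v \<inter> green V \<eta> = {}} \<in> sets ?M"
    unfolding eq using A assms(3) by (intro sets.finite_UN) auto
  assume p: "0 \<le> p" "p \<le> 1" and h: "0 < h"
  have "measure ?M (\<Union>S\<in>Pow F. ?A S) = (\<Sum>S\<in>Pow F. measure ?M (?A S))"
    using assms(3) A by (intro finite_measure_finite_Union) (auto simp: disjoint_family_on_def)
  also have "\<dots> = bernoulli_expectation p F (\<lambda>S. exp (- h * real (card (reach S {v}))))"
    unfolding bernoulli_expectation_def
  proof (rule sum.cong)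
    fix S assume "S \<in> Pow F"
    then have S: "S \<subseteq> F" by simp
    have "measure ?M (?A S) = measure ?B {\<omega> \<in> space ?B. {e\<in>F. \<omega> e} = S} *
        measure ?G {\<eta> \<in> space ?G. reach S {v} \<inter> green V \<eta> = {}}"
      unfolding ghost_percolation_def measure_def enn2real_mult[symmetric]
      by (subst G.emeasure_pair_measure_Times;
          intro sets_open_edges_eq sets_no_green sub fin assms S refl)
    then show "measure ?M (?A S) = bernoulli_weight p F S * exp (- h * real (card (reach S {v})))"
      by (simp add: measure_open_edges_eq[OF assms(2,3) S p] measure_no_green[OF sub fin h, OF S S])
  qed simp
  finally show "measure ?M {(\<omega>, \<eta>) \<in> space ?M. cluster F \<omega> v \<inter> green V \<eta> = {}} =
      bernoulli_expectation p F (\<lambda>S. exp (- h * real (card (reach S {v}))))"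
    unfolding eq .
qed

section \<open>Exhaustion of the graph by finite edge sets\<close>

definition exhaustion :: "'a set \<Rightarrow> nat \<Rightarrow> 'a set" where
  "exhaustion A k = {a \<in> A. to_nat_on A a < k}"

lemma exhaustion_subset: "exhaustion A k \<subseteq> A"
  by (auto simp: exhaustion_def)

lemma exhaustion_mono: "k \<le> l \<Longrightarrow> exhaustion A k \<subseteq> exhaustion A l"
  by (auto simp: exhaustion_def)

lemma finite_exhaustion: "countable A \<Longrightarrow> finite (exhaustion A k)"
  by (rule inj_on_finite[of "to_nat_on A" _ "{..<k}"])
    (auto simp: exhaustion_def inj_on_def)

lemma cluster_mono: "F \<subseteq> F' \<Longrightarrow> cluster F \<omega> v \<subseteq> cluster F' \<omega> v"
  unfolding cluster_eq_reach by (rule reach_mono) auto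

text \<open>
  A path uses finitely many edges. All measurability and limit statements for the cluster in the
  infinite graph are reduced to finite sets of edges through this identity.
\<close>

lemma cluster_exhaustion: "cluster E \<omega> v = (\<Union>k. cluster (exhaustion E k) \<omega> v)"
proof
  show "cluster E \<omega> v \<subseteq> (\<Union>k. cluster (exhaustion E k) \<omega> v)"
    unfolding cluster_eq_reach[of E]
  proof (rule reach_least)
    show "{v} \<subseteq> (\<Union>k. cluster (exhaustion E k) \<omega> v)"
      by (auto simp: cluster_def)
    fix u w assume "u \<in> (\<Union>k. cluster (exhaustion E k) \<omega> v)" and uw: "{u, w} \<in> {e\<in>E. \<omega> e}"
    then obtain k where k: "u \<in> cluster (exhaustion E k) \<omega> v" by blast
    define l where "l = max k (Suc (to_nat_on E {u, w}))"
    have "u \<in> cluster (exhaustion E l) \<omega> v"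
      using k cluster_mono[OF exhaustion_mono[of k l E]] by (auto simp: l_def)
    moreover have "{u, w} \<in> {e\<in>exhaustion E l. \<omega> e}"
      using uw by (auto simp: exhaustion_def l_def)
    ultimately have "w \<in> cluster (exhaustion E l) \<omega> v"
      unfolding cluster_eq_reach by (rule reach_step)
    then show "w \<in> (\<Union>k. cluster (exhaustion E k) \<omega> v)" by blast
  qed
qed (intro UN_least cluster_mono exhaustion_subset)

lemma finite_local_cluster:
  assumes "simple_graph V E" "F \<subseteq> E" "finite F"
  shows "finite (cluster F \<omega> v)"
  unfolding cluster_eq_reach
  by (rule finite_reach) (use assms finite_edge[OF assms(1)] in auto)

lemma ecard_ge_iff: "enat n \<le> ecard A \<longleftrightarrow> (\<exists>B\<subseteq>A. finite B \<and> card B = n)"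
proof
  assume *: "enat n \<le> ecard A"
  show "\<exists>B\<subseteq>A. finite B \<and> card B = n"
  proof (cases "finite A")
    case True
    with * show ?thesis
      using obtain_subset_with_card_n[of n A] finite_subset by (auto simp: ecard_def)
  next
    case False
    then show ?thesis using infinite_arbitrarily_large by blast
  qed
qed (auto simp: ecard_def card_mono)

text \<open>
  The \<open>n\<close> vertices that witness a large cluster are all reached within one member of the exhaustion,
  because the exhaustion is increasing.
\<close>

lemma ecard_cluster_exhaustion:
  assumes "simple_graph V E" "countable E"
  shows "enat n \<le> ecard (cluster E \<omega> v) \<longleftrightarrow> (\<exists>k. n \<le> card (cluster (exhaustion E k) \<omega> v))"
proof
  assume "enat n \<le> ecard (cluster E \<omega> v)"
  then obtain B where B: "B \<subseteq> cluster E \<omega> v" "finite B" "card B = n"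
    by (auto simp: ecard_ge_iff)
  from B(2,1) have "\<exists>k. B \<subseteq> cluster (exhaustion E k) \<omega> v"
  proof (induction B rule: finite_induct)
    case (insert b B)
    then obtain k l where "B \<subseteq> cluster (exhaustion E k) \<omega> v" "b \<in> cluster (exhaustion E l) \<omega> v"
      by (auto simp: cluster_exhaustion[of E])
    then have "insert b B \<subseteq> cluster (exhaustion E (max k l)) \<omega> v"
      using cluster_mono[OF exhaustion_mono[of k "max k l" E]]
        cluster_mono[OF exhaustion_mono[of l "max k l" E]] by fastforce
    then show ?case ..
  qed simp
  then obtain k where "B \<subseteq> cluster (exhaustion E k) \<omega> v" ..
  then have "n \<le> card (cluster (exhaustion E k) \<omega> v)"
    unfolding B(3)[symmetric]
    by (intro card_mono finite_local_cluster[OF assms(1)] exhaustion_subset finite_exhaustion assms(2))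
  then show "\<exists>k. n \<le> card (cluster (exhaustion E k) \<omega> v)" ..
next
  assume "\<exists>k. n \<le> card (cluster (exhaustion E k) \<omega> v)"
  then obtain k B where "B \<subseteq> cluster (exhaustion E k) \<omega> v" "finite B" "card B = n"
    using obtain_subset_with_card_n by metis
  then show "enat n \<le> ecard (cluster E \<omega> v)"
    unfolding ecard_ge_iff using cluster_mono[OF exhaustion_subset[of E k], of \<omega> v] by blast
qed

lemma
  assumes "simple_graph V E" "countable E" "0 \<le> p" "p \<le> 1"
  shows exhaustion_tendsto_\<psi>:
      "(\<lambda>k. bernoulli_expectation p (exhaustion E k) (\<lambda>S. of_bool (n \<le> card (reach S {v}))))
        \<longlonglongrightarrow> \<psi> E v n p"
    and local_le_\<psi>:
      "bernoulli_expectation p (exhaustion E k) (\<lambda>S. of_bool (n \<le> card (reach S {v}))) \<le> \<psi> E v n p"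
proof -
  let ?M = "bond_percolation E p"
  let ?A = "\<lambda>k. {\<omega> \<in> space ?M. n \<le> card (cluster (exhaustion E k) \<omega> v)}"
  interpret prob_space ?M
    unfolding bond_percolation_def by (rule prob_space_bernoulli_field)
  have eq: "{\<omega> \<in> space ?M. enat n \<le> ecard (cluster E \<omega> v)} = (\<Union>k. ?A k)"
    by (auto simp: ecard_cluster_exhaustion[OF assms(1,2)])
  have A: "?A k \<in> sets ?M" for k
    unfolding cluster_eq_reach
    by (rule sets_local_event[OF exhaustion_subset finite_exhaustion[OF assms(2)]])
  have measure_A: "measure ?M (?A k) =
      bernoulli_expectation p (exhaustion E k) (\<lambda>S. of_bool (n \<le> card (reach S {v})))" for k
    unfolding cluster_eq_reach
    by (rule measure_local_event[OF exhaustion_subset finite_exhaustion[OF assms(2)] assms(3,4)])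
  have "incseq ?A"
  proof (rule incseq_SucI)
    fix k
    have "card (cluster (exhaustion E k) \<omega> v) \<le> card (cluster (exhaustion E (Suc k)) \<omega> v)" for \<omega>
      by (intro card_mono cluster_mono exhaustion_mono finite_local_cluster[OF assms(1)]
          exhaustion_subset finite_exhaustion assms(2)) simp
    then show "?A k \<subseteq> ?A (Suc k)"
      using order_trans by blast
  qed
  then have "(\<lambda>k. measure ?M (?A k)) \<longlonglongrightarrow> measure ?M (\<Union>k. ?A k)"
    using A by (intro finite_Lim_measure_incseq) auto
  then show "(\<lambda>k. bernoulli_expectation p (exhaustion E k) (\<lambda>S. of_bool (n \<le> card (reach S {v}))))
        \<longlonglongrightarrow> \<psi> E v n p"
    unfolding \<psi>_def eq measure_A .
  have sets: "{\<omega> \<in> space ?M. enat n \<le> ecard (cluster E \<omega> v)} \<in> sets ?M"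
    unfolding eq using A by (intro sets.countable_UN) auto
  show "bernoulli_expectation p (exhaustion E k) (\<lambda>S. of_bool (n \<le> card (reach S {v}))) \<le> \<psi> E v n p"
    unfolding \<psi>_def measure_A[symmetric]
    using sets by (intro finite_measure_mono) (auto simp: eq)
qed

section \<open>The magnetization\<close>

lemma
  assumes "simple_graph V E" "countable E" "v \<in> V"
  shows sets_cluster_no_green:
      "{(\<omega>, \<eta>) \<in> space (ghost_percolation V E p h). cluster E \<omega> v \<inter> green V \<eta> = {}}
        \<in> sets (ghost_percolation V E p h)"
    and one_minus_magnetization:
      "1 - magnetization V E v h p = measure (ghost_percolation V E p h)
        {(\<omega>, \<eta>) \<in> space (ghost_percolation V E p h). cluster E \<omega> v \<inter> green V \<eta> = {}}"
proof -
  let ?M = "ghost_percolation V E p h"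
  let ?N = "{(\<omega>, \<eta>) \<in> space ?M. cluster E \<omega> v \<inter> green V \<eta> = {}}"
  interpret prob_space ?M by (rule prob_space_ghost_percolation)
  have "?N = (\<Inter>k. {(\<omega>, \<eta>) \<in> space ?M. cluster (exhaustion E k) \<omega> v \<inter> green V \<eta> = {}})"
    by (subst cluster_exhaustion) auto
  also have "\<dots> \<in> sets ?M"
    by (intro sets.countable_INT' sets_local_cluster_no_green[OF assms(1) exhaustion_subset
        finite_exhaustion[OF assms(2)] assms(3)] image_subsetI) auto
  finally show N: "?N \<in> sets ?M" .
  have "{(\<omega>, \<eta>) \<in> space ?M. cluster E \<omega> v \<inter> green V \<eta> \<noteq> {}} = space ?M - ?N"
    by auto
  then show "1 - magnetization V E v h p = measure ?M ?N"
    unfolding magnetization_def by (simp add: prob_compl[OF N])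
qed

lemma one_minus_magnetization_le_local:
  assumes "simple_graph V E" "countable E" "v \<in> V" "F \<subseteq> E" "finite F"
    and "0 \<le> p" "p \<le> 1" "0 < h"
  shows "1 - magnetization V E v h p
    \<le> bernoulli_expectation p F (\<lambda>S. exp (- h * real (card (reach S {v}))))"
proof -
  let ?M = "ghost_percolation V E p h"
  interpret prob_space ?M by (rule prob_space_ghost_percolation)
  have "1 - magnetization V E v h p \<le> measure ?M
      {(\<omega>, \<eta>) \<in> space ?M. cluster F \<omega> v \<inter> green V \<eta> = {}}"
    unfolding one_minus_magnetization[OF assms(1-3)]
  proof (rule finite_measure_mono[OF _ sets_local_cluster_no_green[OF assms(1,4,5,3)]])
    show "{(\<omega>, \<eta>) \<in> space ?M. cluster E \<omega> v \<inter> green V \<eta> = {}}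
        \<subseteq> {(\<omega>, \<eta>) \<in> space ?M. cluster F \<omega> v \<inter> green V \<eta> = {}}"
      using cluster_mono[OF assms(4), of _ v] by blast
  qed
  then show ?thesis
    by (simp add: measure_local_cluster_no_green[OF assms(1,4,5,3,6-8)])
qed

text \<open>
  Invariance of the percolation law under relabelling of the edges, which is used with the action
  of a graph automorphism on edges.
\<close>

lemma bernoulli_expectation_image:
  assumes "finite F" "inj_on g F"
  shows "bernoulli_expectation p (g ` F) f = bernoulli_expectation p F (\<lambda>S. f (g ` S))"
  using assms
proof (induction F arbitrary: f rule: finite_induct)
  case (insert e F)
  then have "g e \<notin> g ` F" "inj_on g F" by auto
  with insert show ?case
    by (simp add: bernoulli_expectation_insert)
qed (simp add: bernoulli_expectation_empty)

text \<open>
  An automorphism taking \<open>y\<close> to \<open>v\<close> carries \<open>F\<close> to another finite set of edges, and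
  \<open>one_minus_magnetization_le_local\<close> holds at \<open>v\<close> for every such set. Thus only the law on finitely
  many edges has to be transported.
\<close>

lemma one_minus_magnetization_le_local_any_vertex:
  assumes "simple_graph V E" "vertex_transitive V E" "countable E" "v \<in> V" "y \<in> V"
    and "F \<subseteq> E" "finite F" "0 \<le> p" "p \<le> 1" "0 < h"
  shows "1 - magnetization V E v h p
    \<le> bernoulli_expectation p F (\<lambda>S. exp (- h * real (card (reach S {y}))))"
proof -
  obtain \<phi> where \<phi>: "graph_automorphism V E \<phi>" "\<phi> y = v"
    using assms(2,4,5) unfolding vertex_transitive_def by blast
  then have inj: "inj_on \<phi> V"
    and edge: "\<And>u w. u \<in> V \<Longrightarrow> w \<in> V \<Longrightarrow> {u, w} \<in> E \<Longrightarrow> {\<phi> u, \<phi> w} \<in> E"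
    by (auto simp: graph_automorphism_def bij_betw_def)
  have E: "\<exists>u\<in>V. \<exists>w\<in>V. e = {u, w}" if "e \<in> E" for e
    using that assms(1) unfolding simple_graph_def by blast
  have F_Pow: "F \<subseteq> Pow V"
    using edge_subset_vertices[OF assms(1)] assms(6) by blast
  have inj_F: "inj_on ((`) \<phi>) F"
    by (rule inj_on_subset[OF inj_on_image_Pow[OF inj] F_Pow])
  have image_F: "(`) \<phi> ` F \<subseteq> E"
  proof
    fix e assume "e \<in> (`) \<phi> ` F"
    then obtain e' where e': "e' \<in> F" "e = \<phi> ` e'" by blast
    then obtain u w where "u \<in> V" "w \<in> V" "e' = {u, w}"
      using E[of e'] assms(6) by blast
    with e' assms(6) edge[of u w] show "e \<in> E" by auto
  qed
  have card: "card (reach S {y}) \<le> card (reach ((`) \<phi> ` S) {v})" if S: "S \<subseteq> F" for S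
  proof -
    have "reach S {y} \<subseteq> {u. \<phi> u \<in> reach ((`) \<phi> ` S) {v}}"
    proof (rule reach_least)
      show "{y} \<subseteq> {u. \<phi> u \<in> reach ((`) \<phi> ` S) {v}}"
        using \<phi>(2) subset_reach[of "{v}"] by blast
      fix u w assume u: "u \<in> {u. \<phi> u \<in> reach ((`) \<phi> ` S) {v}}" and uw: "{u, w} \<in> S"
      from imageI[OF uw, of "(`) \<phi>"] have "{\<phi> u, \<phi> w} \<in> (`) \<phi> ` S" by simp
      with u show "w \<in> {u. \<phi> u \<in> reach ((`) \<phi> ` S) {v}}"
        by (auto intro: reach_step)
    qed
    then have sub: "\<phi> ` reach S {y} \<subseteq> reach ((`) \<phi> ` S) {v}" by blast
    have "reach S {y} \<subseteq> V"
      using reach_subset_Union[of S "{y}"] S F_Pow assms(5) by blast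
    then have "card (reach S {y}) = card (\<phi> ` reach S {y})"
      using card_image inj inj_on_subset by metis
    also have "\<dots> \<le> card (reach ((`) \<phi> ` S) {v})"
    proof (rule card_mono[OF finite_reach sub])
      show "finite ((`) \<phi> ` S)"
        using S assms(7) finite_subset by blast
      fix e assume "e \<in> (`) \<phi> ` S"
      then have "e \<in> E" using S image_F by blast
      then show "finite e" by (rule finite_edge[OF assms(1)])
    qed simp
    finally show ?thesis .
  qed
  have "1 - magnetization V E v h p
      \<le> bernoulli_expectation p ((`) \<phi> ` F) (\<lambda>S. exp (- h * real (card (reach S {v}))))"
    by (rule one_minus_magnetization_le_local) (use assms image_F in auto)
  also have "\<dots> = bernoulli_expectation p F (\<lambda>S. exp (- h * real (card (reach ((`) \<phi> ` S) {v}))))"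
    by (rule bernoulli_expectation_image[OF assms(7) inj_F])
  also have "\<dots> \<le> bernoulli_expectation p F (\<lambda>S. exp (- h * real (card (reach S {y}))))"
    using card assms(10) by (intro bernoulli_expectation_mono assms) simp
  finally show ?thesis .
qed

text \<open>
  With positive probability all the finitely many edges at \<open>v\<close> are closed and \<open>v\<close> is not green.
\<close>

lemma magnetization_less_1:
  assumes "simple_graph V E" "locally_finite_graph V E" "countable E" "v \<in> V"
    and "0 \<le> p" "p < 1" "0 < h"
  shows "magnetization V E v h p < 1"
proof -
  let ?B = "bond_percolation E p" and ?G = "ghost_field V h" and ?M = "ghost_percolation V E p h"
  let ?K = "{e\<in>E. v \<in> e}"
  let ?X = "{\<omega> \<in> space ?B. {e\<in>?K. \<omega> e} = {}}" and ?Y = "{\<eta> \<in> space ?G. {v} \<inter> green V \<eta> = {}}"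
  interpret prob_space ?M by (rule prob_space_ghost_percolation)
  interpret G: prob_space ?G
    unfolding ghost_field_def by (rule prob_space_bernoulli_field)
  have K: "finite ?K"
    using assms(2,4) by (auto simp: locally_finite_graph_def)
  have X: "?X \<in> sets ?B"
    by (intro sets_open_edges_eq K) auto
  have Y: "?Y \<in> sets ?G"
    using assms(4) by (intro sets_no_green) auto
  have iso: "cluster E \<omega> v = {v}" if "{e\<in>?K. \<omega> e} = {}" for \<omega>
    unfolding cluster_eq_reach using that by (intro reach_without_edges) blast
  have "0 < (1 - p) ^ card ?K * exp (- h)"
    using assms by simp
  also have "\<dots> = measure ?B ?X * measure ?G ?Y"
    using measure_open_edges_eq[of ?K E "{}" p] measure_no_green[of "{v}" V h] K assms
    by (simp add: bernoulli_weight_def)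
  also have "\<dots> = measure ?M (?X \<times> ?Y)"
    unfolding ghost_percolation_def measure_def enn2real_mult[symmetric]
    by (simp only: G.emeasure_pair_measure_Times[OF X Y])
  also have "\<dots> \<le> 1 - magnetization V E v h p"
    unfolding one_minus_magnetization[OF assms(1,3,4)]
  proof (rule finite_measure_mono)
    show "?X \<times> ?Y \<subseteq> {(\<omega>, \<eta>) \<in> space ?M. cluster E \<omega> v \<inter> green V \<eta> = {}}"
      using iso by (auto simp: ghost_percolation_def space_pair_measure)
  qed (rule sets_cluster_no_green[OF assms(1,3,4)])
  finally show ?thesis by simp
qed

section \<open>The comparison of cluster sizes\<close>

theorem theorem2:
  fixes V :: "'v set" and E :: "'v set set" and v\<^sub>0 :: 'v and p h q :: real
  assumes "simple_graph V E"
    and "connected_graph V E"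
    and "locally_finite_graph V E"
    and "vertex_transitive V E"
    and "countable V" and "infinite V"
    and "v\<^sub>0 \<in> V"
    and "0 < p" and "p < 1"
    and "0 < h"
    and "q = p * (1 - magnetization V E v\<^sub>0 h p)"
  shows "\<forall>n::nat. \<psi> E v\<^sub>0 n q \<le> 1 / (1 - magnetization V E v\<^sub>0 h p) * \<psi> E v\<^sub>0 n p * exp (- h * real n)"
proof
  fix n :: nat
  define \<theta> where "\<theta> = 1 - magnetization V E v\<^sub>0 h p"
  have E: "countable E"
    using assms by (intro countable_edges)
  have p: "0 \<le> p" "p \<le> 1" using assms by auto
  have \<theta>: "0 < \<theta>"
    using magnetization_less_1[OF assms(1,3) E assms(7) p(1) assms(9,10)] by (simp add: \<theta>_def)
  have "\<theta> \<le> 1"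
    unfolding \<theta>_def magnetization_def by (simp add: measure_nonneg)
  then have q: "0 \<le> q" "q \<le> 1"
    using assms(11) p \<theta> mult_mono[of p 1 \<theta> 1] by (auto simp: \<theta>_def)
  let ?w = "\<lambda>A :: 'v set. exp (- h * real (card A))" and ?g = "\<lambda>A. of_bool (n \<le> card A) :: real"
  have "bernoulli_expectation q (exhaustion E k) (\<lambda>S. ?g (reach S {v\<^sub>0}))
      \<le> 1 / \<theta> * \<psi> E v\<^sub>0 n p * exp (- h * real n)" for k
  proof -
    let ?F = "exhaustion E k"
    note F = exhaustion_subset[of E k] finite_exhaustion[OF E, of k]
    let ?\<psi>q = "bernoulli_expectation q ?F (\<lambda>S. ?g (reach S {v\<^sub>0}))"
    \<comment> \<open>Used at the origin to bound the normalization from below, and at every endpoint of an edge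
      of \<open>F\<close> to verify the hypothesis on \<open>q\<close>.\<close>
    have local: "\<theta> \<le> bernoulli_expectation p ?F (\<lambda>S. ?w (reach S {y}))" if "y \<in> V" for y
      unfolding \<theta>_def using assms E F p that
      by (intro one_minus_magnetization_le_local_any_vertex) auto
    have "0 \<le> ?\<psi>q"
      using bernoulli_expectation_mono[OF q, of ?F "\<lambda>_. 0" "\<lambda>S. ?g (reach S {v\<^sub>0})"]
      by (simp add: bernoulli_expectation_const[OF F(2)])
    then have "?\<psi>q * \<theta> \<le> ?\<psi>q * bernoulli_expectation p ?F (\<lambda>S. ?w (reach S {v\<^sub>0}))"
      by (intro mult_left_mono local assms(7))
    also have "\<dots> \<le> bernoulli_expectation p ?F (\<lambda>S. ?g (reach S {v\<^sub>0}) * ?w (reach S {v\<^sub>0}))"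
    proof (rule tilted_cluster_domination)
      show "\<exists>x y. e = {x, y}" if "e \<in> ?F" for e
        using that F(1) assms(1) unfolding simple_graph_def by blast
      show "?w B \<le> ?w A" if "finite B" "A \<subseteq> B" for A B :: "'v set"
        using card_mono[OF that] assms(10) by simp
      show "?w A * ?w B \<le> ?w (A \<union> B)" for A B :: "'v set"
      proof -
        have "h * real (card (A \<union> B)) \<le> h * (real (card A) + real (card B))"
          using card_Un_le[of A B] assms(10) by (intro mult_left_mono) linarith+
        then show ?thesis
          by (simp add: exp_add[symmetric] algebra_simps)
      qed
      show "?g A \<le> ?g B" if "finite B" "A \<subseteq> B" for A B :: "'v set"
        using card_mono[OF that] by auto
      show "q \<le> p * bernoulli_expectation p ?F (\<lambda>S. ?w (reach S {y}))" if "y \<in> \<Union>?F" for y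
      proof -
        have "y \<in> V"
          using that F(1) edge_subset_vertices[OF assms(1)] by blast
        then show ?thesis
          using local p by (simp add: assms(11) \<theta>_def[symmetric] mult_left_mono)
      qed
    qed (use F p q in auto)
    \<comment> \<open>On the event that the cluster has at least \<open>n\<close> vertices, its weight is at most \<open>exp (- h n)\<close>.\<close>
    also have "\<dots> \<le> bernoulli_expectation p ?F (\<lambda>S. exp (- h * real n) * ?g (reach S {v\<^sub>0}))"
      using assms(10) by (intro bernoulli_expectation_mono p) (auto simp: of_bool_def)
    also have "\<dots> \<le> exp (- h * real n) * \<psi> E v\<^sub>0 n p"
      unfolding bernoulli_expectation_mult_left
      by (intro mult_left_mono local_le_\<psi>[OF assms(1) E p]) simp
    finally show ?thesis
      using \<theta> by (simp add: field_simps)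
  qed
  then show "\<psi> E v\<^sub>0 n q \<le> 1 / (1 - magnetization V E v\<^sub>0 h p) * \<psi> E v\<^sub>0 n p * exp (- h * real n)"
    unfolding \<theta>_def[symmetric]
    by (intro LIMSEQ_le_const2[OF exhaustion_tendsto_\<psi>[OF assms(1) E q]]) blast
qed

end
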